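(* Let $n\geq 2$, let $p>1$ be a real number that is not an even integer, let $f\in L^{\infty}(\mathbb{S}^{n-1})$ be real-valued, and suppose that $$H(x)=\int_{\mathbb{S}^{n-1}}|\langle x,\xi\rangle|^{p}f(\xi)\,d\xi,\qquad x\in\mathbb{R}^n.$$ Let $\alpha=(\alpha_1,\dots,\alpha_n)$ be a multi-index such that $|\alpha|$ is even and $|\alpha|<p+1$. Then $H\in C^{|\alpha|}(\mathbb{R}^n\setminus\{0\})$ and, for every $x\in\mathbb{R}^n\setminus\{0\}$, $$D^{\alpha}H(x)=i^{|\alpha|}\,\frac{C_p}{C_{p-|\alpha|}}\int_{\mathbb{S}^{n-1}}|\langle x,\xi\rangle|^{p-|\alpha|}\,\xi_1^{\alpha_1}\cdots\xi_n^{\alpha_n}f(\xi)\,d\xi .$$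
   Context: $\mathbb{S}^{n-1}$ is the Euclidean unit sphere in $\mathbb{R}^n$, $\langle\cdot,\cdot\rangle$ the standard scalar product, and $d\xi$ the (unnormalized) spherical Lebesgue measure on $\mathbb{S}^{n-1}$. For a multi-index $\alpha=(\alpha_1,\dots,\alpha_n)$ of nonnegative integers, $|\alpha|=\alpha_1+\cdots+\alpha_n$ and $D^{\alpha}=(\partial/\partial x_1)^{\alpha_1}\cdots(\partial/\partial x_n)^{\alpha_n}$. Here $i$ is the imaginary unit (so $i^{|\alpha|}=(-1)^{|\alpha|/2}$). The constants are $$C_t=\frac{2^{t+1}\sqrt{\pi}\,\Gamma((t+1)/2)}{\Gamma(-t/2)}.$$ *)

theory Defs
  imports "HOL-Analysis.Analysis"
begin

text \<open>The index type \<open>'n::{finite,linorder}\<close> plays the role of \<open>{1,...,n}\<close>; its order is used only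
  to fix the order in which the partial derivatives in \<open>multi_deriv\<close> are taken.\<close>

text \<open>The surface measure is introduced through cones: for a Borel set \<open>A\<close> of the sphere,
  \<open>\<sigma>(A) = n \<lambda>({r \<xi> | 0 < r \<le> 1, \<xi> \<in> A})\<close>; see \<open>emeasure_spherical_lebesgue\<close>.
  It is unnormalized, and completed so that its measurable sets are the Lebesgue measurable ones.\<close>

definition spherical_lebesgue :: "'a::euclidean_space measure" where
  "spherical_lebesgue =
     completion (scale_measure (of_nat DIM('a))
       (distr (restrict_space lborel (cball 0 1 - {0})) (restrict_space borel (sphere 0 1))
          (\<lambda>x. x /\<^sub>R norm x)))"

lemma space_spherical_lebesgue [simp]: "space (spherical_lebesgue :: 'a::euclidean_space measure) = sphere 0 1"
  by (simp add: spherical_lebesgue_def space_restrict_space space_scale_measure)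

lemma emeasure_spherical_lebesgue:
  fixes A :: "'a::euclidean_space set"
  assumes "A \<in> sets borel" and "A \<subseteq> sphere 0 1"
  shows "emeasure spherical_lebesgue A =
           of_nat DIM('a) * emeasure lborel {r *\<^sub>R \<xi> | r \<xi>. 0 < r \<and> r \<le> 1 \<and> \<xi> \<in> A}"
proof -
  let ?B = "cball 0 1 - {0::'a}"
  let ?S = "restrict_space borel (sphere (0::'a) 1)"
  let ?g = "\<lambda>x::'a. x /\<^sub>R norm x"
  have B: "?B \<in> sets borel" by auto
  have A: "A \<in> sets ?S" using assms by (auto simp: sets_restrict_space)
  have g: "?g \<in> measurable (restrict_space lborel ?B) ?S"
    by (rule measurable_restrict_space2) (auto simp: space_restrict_space intro!: measurable_restrict_space1)
  have cone: "?g -` A \<inter> ?B = {r *\<^sub>R \<xi> | r \<xi>. 0 < r \<and> r \<le> 1 \<and> \<xi> \<in> A}"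
  proof (intro equalityI subsetI)
    fix x assume x: "x \<in> ?g -` A \<inter> ?B"
    then have "x = norm x *\<^sub>R ?g x" "0 < norm x" "norm x \<le> 1" "?g x \<in> A" by auto
    then show "x \<in> {r *\<^sub>R \<xi> | r \<xi>. 0 < r \<and> r \<le> 1 \<and> \<xi> \<in> A}" by blast
  next
    fix x assume "x \<in> {r *\<^sub>R \<xi> | r \<xi>. 0 < r \<and> r \<le> 1 \<and> \<xi> \<in> A}"
    then obtain r \<xi> where "x = r *\<^sub>R \<xi>" "0 < r" "r \<le> 1" "\<xi> \<in> A" by blast
    moreover have "norm \<xi> = 1" using \<open>\<xi> \<in> A\<close> assms(2) by auto
    ultimately show "x \<in> ?g -` A \<inter> ?B" by auto
  qed
  have "emeasure spherical_lebesgue A =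
      of_nat DIM('a) * emeasure (restrict_space lborel ?B) (?g -` A \<inter> ?B)"
    using A g by (simp add: spherical_lebesgue_def emeasure_distr space_restrict_space)
  also have "emeasure (restrict_space lborel ?B) (?g -` A \<inter> ?B) = emeasure lborel (?g -` A \<inter> ?B)"
    using B by (intro emeasure_restrict_space) auto
  finally show ?thesis unfolding cone .
qed

definition L_infinity :: "'a measure \<Rightarrow> ('a \<Rightarrow> real) set" where
  "L_infinity M = {f \<in> borel_measurable M. \<exists>B. AE x in M. \<bar>f x\<bar> \<le> B}"

definition partial_deriv :: "'n::finite \<Rightarrow> (real^'n \<Rightarrow> real) \<Rightarrow> real^'n \<Rightarrow> real" where
  "partial_deriv j g x = deriv (\<lambda>t. g (x + t *\<^sub>R axis j 1)) 0"

text \<open>Since \<open>deriv\<close> is total, existence of each partial derivative is demanded explicitly.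
  Intended for open \<open>S\<close>.\<close>

fun C_k_on :: "nat \<Rightarrow> (real^'n::finite \<Rightarrow> real) \<Rightarrow> (real^'n) set \<Rightarrow> bool" where
  "C_k_on 0 g S \<longleftrightarrow> continuous_on S g"
| "C_k_on (Suc k) g S \<longleftrightarrow> continuous_on S g \<and>
     (\<forall>j. (\<forall>x\<in>S. (\<lambda>t. g (x + t *\<^sub>R axis j 1)) field_differentiable (at (0::real))) \<and>
          C_k_on k (partial_deriv j g) S)"

text \<open>\<open>(\<partial>/\<partial>x\<^sub>1)\<^bsup>\<alpha>\<^sub>1\<^esup> \<dots> (\<partial>/\<partial>x\<^sub>n)\<^bsup>\<alpha>\<^sub>n\<^esup>\<close>, the last factor being applied first.\<close>

definition multi_deriv ::
  "('n::{finite,linorder} \<Rightarrow> nat) \<Rightarrow> (real^'n::{finite,linorder} \<Rightarrow> real) \<Rightarrow> real^'n::{finite,linorder} \<Rightarrow> real" where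
  "multi_deriv \<alpha> g = foldr (\<lambda>j. partial_deriv j ^^ \<alpha> j) (sorted_list_of_set UNIV) g"

definition C_const :: "real \<Rightarrow> real" where
  "C_const t = 2 powr (t + 1) * sqrt pi * Gamma ((t + 1) / 2) / Gamma (- t / 2)"

end

theory Submission
  imports Defs
begin

text \<open>Differentiating \<open>\<bar>\<langle>x,\<xi>\<rangle>\<bar>\<^sup>p\<close> under the integral \<open>m\<close> times produces the kernels
  \<open>p (p - 1) \<dots> (p - m + 1) sgn\<^sup>m \<langle>x,\<xi>\<rangle> \<bar>\<langle>x,\<xi>\<rangle>\<bar>\<^bsup>p-m\<^esup>\<close>, and the numerical factor is
  \<open>i\<^sup>m C\<^sub>p / C\<^bsub>p-m\<^esub>\<close> for even \<open>m\<close> because \<open>C\<^sub>t = - t (t - 1) C\<^bsub>t-2\<^esub>\<close>. The only delicate step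
  is the last one, where the exponent may drop into \<open>(-1, 0)\<close>. There the integral of
  \<open>\<bar>\<langle>y,\<xi>\<rangle>\<bar>\<^sup>s\<close> is still \<open>O(\<bar>y\<bar>\<^sup>s)\<close>, so dominated convergence gives the derivative. Its continuity
  follows from a Hoelder estimate for the kernel, which sacrifices a little of the exponent.\<close>

section \<open>Integration over the sphere\<close>

text \<open>Completion does not change nonnegative integrals, so this is the change of variables for
  the push-forward under radial projection. It turns spherical integrals into Lebesgue integrals
  over the punctured unit ball, where translation invariance is available.\<close>

lemma nn_integral_spherical_lebesgue:
  fixes h :: "'a::euclidean_space \<Rightarrow> ennreal"
  assumes [measurable]: "h \<in> borel_measurable borel"
  shows "(\<integral>\<^sup>+\<xi>. h \<xi> \<partial>spherical_lebesgue) =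
    of_nat DIM('a) * (\<integral>\<^sup>+x. h (x /\<^sub>R norm x) * indicator (cball 0 1 - {0}) x \<partial>lborel)"
proof -
  let ?B = "cball 0 1 - {0::'a}"
  let ?S = "restrict_space borel (sphere (0::'a) 1)"
  let ?g = "\<lambda>x::'a. x /\<^sub>R norm x"
  have g: "?g \<in> measurable (restrict_space lborel ?B) ?S"
    by (rule measurable_restrict_space2) (auto simp: space_restrict_space intro!: measurable_restrict_space1)
  have h: "h \<in> borel_measurable ?S"
    by (intro measurable_restrict_space1) simp
  have B: "?B \<in> sets borel" by auto
  show ?thesis
    unfolding spherical_lebesgue_def nn_integral_completion
    using g h B
    by (simp add: nn_integral_scale_measure nn_integral_distr nn_integral_restrict_space)
qed

lemma borel_measurable_spherical_lebesgue:
  "h \<in> borel_measurable borel \<Longrightarrow> h \<in> borel_measurable spherical_lebesgue"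
  unfolding spherical_lebesgue_def
  by (intro measurable_completion) (simp add: measurable_restrict_space1 cong: measurable_cong_sets)

lemma finite_measure_spherical_lebesgue:
  "finite_measure (spherical_lebesgue :: 'a::euclidean_space measure)"
proof
  have "emeasure spherical_lebesgue (sphere (0::'a) 1)
      = (\<integral>\<^sup>+\<xi>. 1 \<partial>(spherical_lebesgue :: 'a measure))"
    by (metis nn_integral_const mult_1 space_spherical_lebesgue)
  also have "\<dots> = of_nat DIM('a) * (\<integral>\<^sup>+x. indicator (cball 0 1 - {0::'a}) x \<partial>lborel)"
    by (subst nn_integral_spherical_lebesgue) auto
  also have "\<dots> = of_nat DIM('a) * emeasure lborel (cball 0 1 - {0::'a})"
    by simp
  also have "\<dots> \<le> of_nat DIM('a) * emeasure lborel (cball (0::'a) 1)"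
    by (intro mult_left_mono emeasure_mono) auto
  also have "\<dots> < \<infinity>"
    using emeasure_lborel_cball_finite[of "0::'a" 1] by (simp add: ennreal_mult_less_top of_nat_less_top)
  finally show "emeasure (spherical_lebesgue :: 'a measure) (space spherical_lebesgue) \<noteq> \<infinity>"
    by simp
qed

text \<open>Averaging over the translations of the unit ball by \<open>s *\<^sub>R y /\<^sub>R norm y\<close> with \<open>0 \<le> s \<le> 1\<close>
  reduces integrals of ridge functions to one-dimensional ones, without a rotation of coordinates.\<close>

lemma nn_integral_ridge_le:
  fixes y :: "'a::euclidean_space" and g :: "real \<Rightarrow> ennreal"
  assumes [measurable]: "g \<in> borel_measurable borel" and y: "y \<noteq> 0"
    and K: "\<And>c. (\<integral>\<^sup>+s. g (c + s * norm y) * indicator {0..1} s \<partial>lborel) \<le> K"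
  shows "(\<integral>\<^sup>+x. g (y \<bullet> x) * indicator (cball 0 1) x \<partial>lborel) \<le> K * emeasure lborel (cball (0::'a) 2)"
proof -
  have [measurable]: "cball (0::'a) r \<in> sets borel" for r by simp
  define u where "u = y /\<^sub>R norm y"
  have u: "norm u = 1" "y \<bullet> u = norm y"
    using y by (auto simp: u_def dot_square_norm power2_eq_square field_simps)
  let ?I = "\<integral>\<^sup>+x. g (y \<bullet> x) * indicator (cball 0 1) x \<partial>lborel"
  \<comment> \<open>Translation by \<open>s *\<^sub>R u\<close> shifts the inner product with
    \<open>y\<close> by \<open>s * norm y\<close>, because \<open>y \<bullet> u = norm y\<close>. As
    \<open>u\<close> is a unit vector and \<open>s \<le> 1\<close>, the translated unit ball stays
    inside the ball of radius 2.\<close>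
  have shift: "?I \<le> (\<integral>\<^sup>+x. g (y \<bullet> x + s * norm y) * indicator (cball (0::'a) 2) x \<partial>lborel)"
    if s: "s \<in> {0..1}" for s
  proof -
    have "?I = (\<integral>\<^sup>+x. g (y \<bullet> x) * indicator (cball 0 1) x \<partial>distr lborel borel ((+) (s *\<^sub>R u)))"
      by (simp add: lborel_distr_plus)
    also have "\<dots> = (\<integral>\<^sup>+x. g (y \<bullet> (s *\<^sub>R u + x)) * indicator (cball 0 1) (s *\<^sub>R u + x) \<partial>lborel)"
      by (subst nn_integral_distr; measurable)
    also have "\<dots> \<le> (\<integral>\<^sup>+x. g (y \<bullet> x + s * norm y) * indicator (cball (0::'a) 2) x \<partial>lborel)"
    proof (intro nn_integral_mono)
      fix x :: 'a
      have "norm x \<le> norm (s *\<^sub>R u + x) + norm (s *\<^sub>R u)"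
        using norm_triangle_ineq4[of "s *\<^sub>R u + x" "s *\<^sub>R u"] by simp
      then have "x \<in> cball 0 2" if "s *\<^sub>R u + x \<in> cball 0 1"
        using that s u by simp
      then show "g (y \<bullet> (s *\<^sub>R u + x)) * indicator (cball 0 1) (s *\<^sub>R u + x)
          \<le> g (y \<bullet> x + s * norm y) * indicator (cball 0 2) x"
        using u by (auto simp: indicator_def inner_add_right add.commute)
    qed
    finally show ?thesis .
  qed
  \<comment> \<open>The left-hand side does not depend on \<open>s\<close>, so averaging over an
    interval of length 1 leaves it unchanged. After the interchange of integrals, \<open>K\<close>
    bounds the integral over \<open>s\<close> with \<open>c = y \<bullet> x\<close>.\<close>
  have "?I = (\<integral>\<^sup>+s. ?I * indicator {0..1::real} s \<partial>lborel)"
    by (simp add: nn_integral_cmult)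
  also have "\<dots> \<le> (\<integral>\<^sup>+s. (\<integral>\<^sup>+x. g (y \<bullet> x + s * norm y) * indicator (cball (0::'a) 2) x
      * indicator {0..1} s \<partial>lborel) \<partial>lborel)"
    using shift by (intro nn_integral_mono) (auto simp: indicator_def)
  also have "\<dots> = (\<integral>\<^sup>+x. (\<integral>\<^sup>+s. g (y \<bullet> x + s * norm y) * indicator (cball (0::'a) 2) x
      * indicator {0..1} s \<partial>lborel) \<partial>lborel)"
    by (intro lborel_pair.Fubini') measurable
  also have "\<dots> = (\<integral>\<^sup>+x. (\<integral>\<^sup>+s. g (y \<bullet> x + s * norm y) * indicator {0..1} s \<partial>lborel)
      * indicator (cball (0::'a) 2) x \<partial>lborel)"
    by (intro nn_integral_cong) (auto simp: indicator_def)
  also have "\<dots> \<le> (\<integral>\<^sup>+x. K * indicator (cball (0::'a) 2) x \<partial>lborel)"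
    using K by (intro nn_integral_mono mult_right_mono) auto
  also have "\<dots> = K * emeasure lborel (cball (0::'a) 2)"
    by (simp add: nn_integral_cmult)
  finally show ?thesis .
qed

text \<open>A line in direction \<open>y\<close> meets the hyperplane orthogonal to \<open>y\<close>
  in a single point, so \<open>nn_integral_ridge_le\<close> applies to the indicator of
  \<open>{0}\<close> with \<open>K = 0\<close>. The singularity of the kernels at 0 can therefore be
  ignored in pointwise limits under the integral.\<close>

lemma AE_spherical_lebesgue_inner_neq_0:
  fixes y :: "'a::euclidean_space"
  assumes "y \<noteq> 0"
  shows "AE \<xi> in spherical_lebesgue. y \<bullet> \<xi> \<noteq> 0"
proof -
  have "(\<integral>\<^sup>+s. indicator {0::real} (c + s * norm y) * indicator {0..1} s \<partial>lborel) \<le> (0::ennreal)" for c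
  proof -
    have "(\<integral>\<^sup>+s. indicator {0::real} (c + s * norm y) * indicator {0..1} s \<partial>lborel)
        \<le> (\<integral>\<^sup>+s. indicator {- c / norm y} s \<partial>lborel)"
      using assms by (intro nn_integral_mono) (auto simp: indicator_def field_simps)
    then show ?thesis by simp
  qed
  from nn_integral_ridge_le[OF _ assms this]
  have 0: "(\<integral>\<^sup>+x. indicator {0} (y \<bullet> x) * indicator (cball 0 1) x \<partial>lborel) = 0"
    by simp
  have "(\<integral>\<^sup>+\<xi>. indicator {0::real} (y \<bullet> \<xi>) \<partial>spherical_lebesgue)
      = of_nat DIM('a) * (\<integral>\<^sup>+x. indicator {0::real} (y \<bullet> (x /\<^sub>R norm x)) * indicator (cball 0 1 - {0}) x \<partial>lborel)"
    by (rule nn_integral_spherical_lebesgue) measurable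
  also have "(\<integral>\<^sup>+x. indicator {0::real} (y \<bullet> (x /\<^sub>R norm x)) * indicator (cball 0 1 - {0}) x \<partial>lborel)
      \<le> (\<integral>\<^sup>+x. indicator {0} (y \<bullet> x) * indicator (cball 0 1) x \<partial>lborel)"
    by (intro nn_integral_mono) (auto simp: indicator_def)
  finally have "(\<integral>\<^sup>+\<xi>. indicator {0::real} (y \<bullet> \<xi>) \<partial>spherical_lebesgue) = 0"
    using 0 by (simp add: mult_left_mono)
  then have "AE \<xi> in spherical_lebesgue. (indicator {0::real} (y \<bullet> \<xi>) :: ennreal) = 0"
    by (subst (asm) nn_integral_0_iff_AE) (auto intro!: borel_measurable_spherical_lebesgue)
  then show ?thesis
    by eventually_elim (auto simp: indicator_def split: if_splits)
qed

text \<open>The point is uniformity in \<open>c\<close>. With the singularity moved to 0, each half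
  of \<open>{-1..1}\<close> contributes at most \<open>1 / (s + 1)\<close>; outside, the integrand
  is at most 1 because \<open>s < 0\<close>, and the domain has length 1.\<close>

lemma nn_integral_powr_translate_le:
  assumes s: "-1 < s" "s < 0"
  shows "(\<integral>\<^sup>+t. ennreal (\<bar>c + t\<bar> powr s) * indicator {0..1} t \<partial>lborel) \<le> ennreal (2 / (s + 1) + 1)"
proof -
  have 1: "(\<integral>\<^sup>+t. ennreal (t powr s) * indicator {0..1} t \<partial>lborel) = ennreal (1 / (s + 1))"
    using nn_integral_has_integral_lebesgue'[OF _ has_integral_powr_from_0[of s 1]] s by simp
  have 2: "(\<integral>\<^sup>+t. ennreal ((-t) powr s) * indicator {0..1} (-t) \<partial>lborel) = ennreal (1 / (s + 1))"
    using nn_integral_real_affine[of "\<lambda>t. ennreal (t powr s) * indicator {0..1} t" "-1" 0] 1 by simp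
  have "(\<integral>\<^sup>+t. ennreal (\<bar>c + t\<bar> powr s) * indicator {0..1} t \<partial>lborel)
      = (\<integral>\<^sup>+t. ennreal (\<bar>t\<bar> powr s) * indicator {0..1} (t - c) \<partial>lborel)"
    using nn_integral_real_affine[of "\<lambda>t. ennreal (\<bar>t\<bar> powr s) * indicator {0..1} (t - c)" 1 c] by simp
  also have "\<dots> \<le> (\<integral>\<^sup>+t. (ennreal (t powr s) * indicator {0..1} t
      + ennreal ((-t) powr s) * indicator {0..1} (-t)) + indicator {c..c+1} t \<partial>lborel)"
  proof (intro nn_integral_mono)
    fix t :: real
    consider "0 \<le> t" "t \<le> 1" | "-1 \<le> t" "t < 0" | "1 < \<bar>t\<bar>" by linarith
    then show "ennreal (\<bar>t\<bar> powr s) * indicator {0..1} (t - c)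
      \<le> (ennreal (t powr s) * indicator {0..1} t
      + ennreal ((-t) powr s) * indicator {0..1} (-t)) + indicator {c..c+1} t"
    proof cases
      case 1
      then show ?thesis by (auto simp: indicator_def add.assoc)
    next
      case 2
      then show ?thesis by (auto simp: indicator_def add_increasing2)
    next
      case 3
      then have "\<bar>t\<bar> powr s \<le> \<bar>t\<bar> powr 0" using s by (intro powr_mono) auto
      also have "\<bar>t\<bar> powr 0 = 1" using 3 by auto
      finally have "\<bar>t\<bar> powr s \<le> 1" .
      then show ?thesis by (auto simp: indicator_def intro!: add_increasing)
    qed
  qed
  also have "\<dots> = ennreal (1 / (s + 1)) + ennreal (1 / (s + 1)) + 1"
    by (simp add: nn_integral_add 1 2)
  also have "\<dots> = ennreal (2 / (s + 1) + 1)"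
    using s by (simp flip: ennreal_plus ennreal_1)
  finally show ?thesis .
qed

text \<open>Factoring \<open>norm y\<close> out of \<open>c + t * norm y\<close> produces the
  homogeneity \<open>norm y powr s\<close>. What remains is the one-dimensional bound, uniform in
  the translation, as required by \<open>nn_integral_ridge_le\<close>.\<close>

lemma nn_integral_powr_inner_spherical_le:
  assumes s: "-1 < s" "s < 0"
  obtains C where "C \<ge> 0" "\<And>y::'a::euclidean_space. y \<noteq> 0 \<Longrightarrow>
    (\<integral>\<^sup>+\<xi>. ennreal (\<bar>y \<bullet> \<xi>\<bar> powr s) \<partial>spherical_lebesgue) \<le> ennreal (C * norm y powr s)"
proof
  let ?V = "measure lborel (cball (0::'a) 2)"
  show "real DIM('a) * (2 / (s + 1) + 1) * ?V \<ge> 0" using s by simp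
  fix y :: 'a assume y: "y \<noteq> 0"
  have scaled: "(\<integral>\<^sup>+t. ennreal (\<bar>c + t * norm y\<bar> powr s) * indicator {0..1} t \<partial>lborel)
      \<le> ennreal (norm y powr s * (2 / (s + 1) + 1))" for c
  proof -
    have "\<bar>c + t * norm y\<bar> = norm y * \<bar>c / norm y + t\<bar>" for t
    proof -
      have "c + t * norm y = norm y * (c / norm y + t)"
        using y by (simp add: field_simps)
      then show ?thesis by (simp only: abs_mult abs_norm_cancel)
    qed
    then have "(\<integral>\<^sup>+t. ennreal (\<bar>c + t * norm y\<bar> powr s) * indicator {0..1} t \<partial>lborel) =
        ennreal (norm y powr s) * (\<integral>\<^sup>+t. ennreal (\<bar>c / norm y + t\<bar> powr s) * indicator {0..1} t \<partial>lborel)"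
      by (simp add: powr_mult ennreal_mult mult.assoc nn_integral_cmult)
    also have "\<dots> \<le> ennreal (norm y powr s) * ennreal (2 / (s + 1) + 1)"
      using nn_integral_powr_translate_le[OF s] by (intro mult_left_mono) auto
    finally show ?thesis using s by (simp add: ennreal_mult)
  qed
  have V: "emeasure lborel (cball (0::'a) 2) = ennreal ?V"
    using emeasure_lborel_cball_finite[of "0::'a" 2] by (intro emeasure_eq_ennreal_measure) auto
  from nn_integral_ridge_le[OF _ y scaled]
  have *: "(\<integral>\<^sup>+x. ennreal (\<bar>y \<bullet> x\<bar> powr s) * indicator (cball 0 1) x \<partial>lborel)
      \<le> ennreal (norm y powr s * (2 / (s + 1) + 1)) * ennreal ?V"
    using s y by (subst V[symmetric]) simp
  have "(\<integral>\<^sup>+\<xi>. ennreal (\<bar>y \<bullet> \<xi>\<bar> powr s) \<partial>spherical_lebesgue) = of_nat DIM('a) *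
      (\<integral>\<^sup>+x. ennreal (\<bar>y \<bullet> (x /\<^sub>R norm x)\<bar> powr s) * indicator (cball 0 1 - {0}) x \<partial>lborel)"
    by (rule nn_integral_spherical_lebesgue) measurable
  also have "(\<integral>\<^sup>+x. ennreal (\<bar>y \<bullet> (x /\<^sub>R norm x)\<bar> powr s) * indicator (cball 0 1 - {0}) x \<partial>lborel)
      \<le> (\<integral>\<^sup>+x. ennreal (\<bar>y \<bullet> x\<bar> powr s) * indicator (cball 0 1) x \<partial>lborel)"
  proof (intro nn_integral_mono)
    fix x :: 'a
    \<comment> \<open>Normalizing \<open>x\<close> with \<open>norm x \<le> 1\<close> can only
      increase the absolute inner product, hence decreases its negative power. If the inner product
      is 0, both sides are 0, since \<open>0 powr s = 0\<close>.\<close>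
    have "\<bar>y \<bullet> (x /\<^sub>R norm x)\<bar> powr s \<le> \<bar>y \<bullet> x\<bar> powr s" if "x \<noteq> 0" "norm x \<le> 1"
    proof (cases "y \<bullet> x = 0")
      case False
      have "\<bar>y \<bullet> x\<bar> \<le> \<bar>y \<bullet> (x /\<^sub>R norm x)\<bar>"
        using that by (simp add: abs_mult field_simps mult_left_le_one_le)
      then show ?thesis using False s by (intro powr_mono2') auto
    qed auto
    then show "ennreal (\<bar>y \<bullet> (x /\<^sub>R norm x)\<bar> powr s) * indicator (cball 0 1 - {0}) x
        \<le> ennreal (\<bar>y \<bullet> x\<bar> powr s) * indicator (cball 0 1) x"
      by (auto simp: indicator_def)
  qed
  also note *
  finally have "(\<integral>\<^sup>+\<xi>. ennreal (\<bar>y \<bullet> \<xi>\<bar> powr s) \<partial>spherical_lebesgue)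
      \<le> ennreal (real DIM('a)) * (ennreal (norm y powr s * (2 / (s + 1) + 1)) * ennreal ?V)"
    by (simp add: mult_left_mono ennreal_of_nat_eq_real_of_nat)
  also have "\<dots> = ennreal (real DIM('a) * (2 / (s + 1) + 1) * ?V * norm y powr s)"
    using s by (simp add: mult_ac flip: ennreal_mult)
  finally show "(\<integral>\<^sup>+\<xi>. ennreal (\<bar>y \<bullet> \<xi>\<bar> powr s) \<partial>spherical_lebesgue)
    \<le> ennreal (real DIM('a) * (2 / (s + 1) + 1) * ?V * norm y powr s)" .
qed

section \<open>Signed powers\<close>

text \<open>Only the parity of \<open>m\<close> matters, but a counter lets each differentiation
  raise \<open>m\<close> and lower \<open>s\<close> by one. Because \<open>0 powr s = 0\<close>, the
  value at 0 is 0 for all \<open>m\<close> and \<open>s\<close>, even for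
  \<open>s \<le> 0\<close>.\<close>

definition signed_powr :: "nat \<Rightarrow> real \<Rightarrow> real \<Rightarrow> real" where
  "signed_powr m s t = sgn t ^ m * \<bar>t\<bar> powr s"

lemma abs_signed_powr [simp]: "\<bar>signed_powr m s t\<bar> = \<bar>t\<bar> powr s"
  by (cases "t = 0") (auto simp: signed_powr_def abs_mult power_abs)

lemma signed_powr_0 [simp]: "signed_powr m s 0 = 0"
  by (simp add: signed_powr_def)

lemma borel_measurable_signed_powr [measurable]: "signed_powr m s \<in> borel_measurable borel"
  unfolding signed_powr_def sgn_if by measurable

lemma has_real_derivative_signed_powr:
  assumes "t \<noteq> 0"
  shows "(signed_powr m s has_real_derivative s * signed_powr (Suc m) (s - 1) t) (at t)"
proof (cases "t > 0")
  case True
  have "((\<lambda>t. t powr s) has_real_derivative s * signed_powr (Suc m) (s - 1) t) (at t)"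
    using True by (auto intro!: derivative_eq_intros simp: signed_powr_def)
  then show ?thesis
    by (rule has_field_derivative_transform_within_open[where S = "{0<..}"])
      (use True in \<open>auto simp: signed_powr_def\<close>)
next
  case False
  then have t: "t < 0" using assms by simp
  have "((\<lambda>t. (-1) ^ m * (- t) powr s) has_real_derivative s * signed_powr (Suc m) (s - 1) t) (at t)"
    using t by (auto intro!: derivative_eq_intros simp: signed_powr_def)
  then show ?thesis
    by (rule has_field_derivative_transform_within_open[where S = "{..<0}"])
      (use t in \<open>auto simp: signed_powr_def\<close>)
qed

lemma isCont_signed_powr: "t \<noteq> 0 \<Longrightarrow> isCont (signed_powr m s) t"
  by (rule DERIV_isCont[OF has_real_derivative_signed_powr])

text \<open>Reduces the two estimates below to powers of absolute values, for all \<open>m\<close>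
  at once. Equal signs factor out with absolute value 1, and opposite signs cost at most the sum of
  the two powers.\<close>

lemma abs_signed_powr_diff_le:
  assumes "a * b < 0 \<Longrightarrow> \<bar>a\<bar> powr s + \<bar>b\<bar> powr s \<le> R"
    and "\<bar>\<bar>a\<bar> powr s - \<bar>b\<bar> powr s\<bar> \<le> R"
  shows "\<bar>signed_powr m s a - signed_powr m s b\<bar> \<le> R"
proof -
  consider "a * b < 0" | "a = 0 \<or> b = 0" | "a \<noteq> 0" "sgn a = sgn b"
    by (metis linorder_neqE_linordered_idom mult_neg_pos mult_pos_neg sgn_neg sgn_pos)
  then show ?thesis
  proof cases
    case 1
    have "\<bar>signed_powr m s a - signed_powr m s b\<bar> \<le> \<bar>a\<bar> powr s + \<bar>b\<bar> powr s"
      using abs_triangle_ineq4[of "signed_powr m s a" "signed_powr m s b"] by simp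
    with 1 assms show ?thesis by linarith
  next
    case 2
    then show ?thesis using assms(2) by auto
  next
    case 3
    then have b: "b \<noteq> 0" by (auto simp: sgn_0_0)
    have "signed_powr m s a - signed_powr m s b = sgn a ^ m * (\<bar>a\<bar> powr s - \<bar>b\<bar> powr s)"
      using 3 by (simp add: signed_powr_def algebra_simps)
    then have "\<bar>signed_powr m s a - signed_powr m s b\<bar> = \<bar>\<bar>a\<bar> powr s - \<bar>b\<bar> powr s\<bar>"
      using 3 b by (simp add: abs_mult power_abs abs_sgn_eq sgn_0_0)
    then show ?thesis using assms(2) by simp
  qed
qed

text \<open>Below degree \<open>0\<close> the functions \<open>signed_powr m s\<close> are unbounded; this estimate makes up for the
  missing dominating function in the proof that their ridge integrals are continuous.\<close>

lemma signed_powr_holder: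
  assumes s: "-1 \<le> s" "s \<le> 0" and e: "0 \<le> e" "e \<le> 1"
  shows "\<bar>signed_powr m s a - signed_powr m s b\<bar> \<le>
    \<bar>a - b\<bar> powr e * (\<bar>a\<bar> powr (s - e) + \<bar>b\<bar> powr (s - e))"
proof (rule abs_signed_powr_diff_le)
  assume ab: "a * b < 0"
  \<comment> \<open>For opposite signs the distance \<open>\<bar>a - b\<bar>\<close> exceeds both
    absolute values, so \<open>\<bar>t\<bar> powr e\<close> may be traded for
    \<open>\<bar>a - b\<bar> powr e\<close>.\<close>
  have "\<bar>t\<bar> powr s \<le> \<bar>a - b\<bar> powr e * \<bar>t\<bar> powr (s - e)" if "t = a \<or> t = b" for t
  proof -
    have "\<bar>t\<bar> \<le> \<bar>a - b\<bar>" using ab that by (auto simp: mult_less_0_iff)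
    then have "\<bar>t\<bar> powr e * \<bar>t\<bar> powr (s - e) \<le> \<bar>a - b\<bar> powr e * \<bar>t\<bar> powr (s - e)"
      using e by (intro mult_right_mono powr_mono2) auto
    then show ?thesis by (simp flip: powr_add)
  qed
  from this[of a] this[of b]
  show "\<bar>a\<bar> powr s + \<bar>b\<bar> powr s \<le> \<bar>a - b\<bar> powr e * (\<bar>a\<bar> powr (s - e) + \<bar>b\<bar> powr (s - e))"
    by (simp add: distrib_left)
next
  have *: "\<bar>x powr s - y powr s\<bar> \<le> (y - x) powr e * (x powr (s - e) + y powr (s - e))"
    if xy: "0 \<le> x" "x \<le> y" for x y
  proof (cases "x = 0")
    \<comment> \<open>Both powers of \<open>x\<close> are 0 by convention, so the claim is an
      equality, \<open>y powr s = y powr e * y powr (s - e)\<close>.\<close>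
    case True
    then show ?thesis by (simp flip: powr_add)
  next
    case False
    then have x: "0 < x" using xy by simp
    then have y: "0 < y" using xy by simp
    \<comment> \<open>The relative increment \<open>q = 1 - x / y\<close>. From
      \<open>-1 \<le> s\<close> follows \<open>x / y \<le> (y / x) powr s\<close>, hence
      \<open>1 - (y / x) powr s \<le> q\<close>. As \<open>q\<close> lies in the unit interval,
      \<open>q \<le> q powr e\<close>, and lowering the denominator from \<open>y\<close> to
      \<open>x\<close> gives the required power of \<open>x\<close>.\<close>
    define q where "q = (y - x) / y"
    have q: "0 \<le> q" "q \<le> 1" using x y xy by (auto simp: q_def)
    have "y powr s \<le> x powr s" using x xy s by (intro powr_mono2') auto
    then have "\<bar>x powr s - y powr s\<bar> = x powr s * (1 - (y / x) powr s)"
      using x y by (simp add: powr_divide right_diff_distrib)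
    also have "(y / x) powr (-1) \<le> (y / x) powr s"
      using s x xy by (intro powr_mono) auto
    then have "1 - (y / x) powr s \<le> q"
      using x y by (simp add: powr_minus_divide q_def diff_divide_distrib)
    also have "q powr 1 \<le> q powr e" using q e by (intro powr_mono') auto
    then have "q \<le> q powr e" using q by simp
    also have "q powr e \<le> (y - x) powr e / x powr e"
      unfolding q_def using x y xy e
      by (auto simp: powr_divide intro!: divide_left_mono powr_mono2)
    finally have "\<bar>x powr s - y powr s\<bar> \<le> x powr s * ((y - x) powr e / x powr e)"
      using x by simp
    also have "\<dots> = (y - x) powr e * x powr (s - e)"
      by (simp add: powr_diff)
    also have "\<dots> \<le> (y - x) powr e * (x powr (s - e) + y powr (s - e))"
      by (intro mult_left_mono) auto
    finally show ?thesis .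
  qed
  have d: "\<bar>\<bar>a\<bar> - \<bar>b\<bar>\<bar> powr e \<le> \<bar>a - b\<bar> powr e"
    using e by (intro powr_mono2) auto
  have "\<bar>\<bar>a\<bar> powr s - \<bar>b\<bar> powr s\<bar> \<le> \<bar>\<bar>a\<bar> - \<bar>b\<bar>\<bar> powr e * (\<bar>a\<bar> powr (s - e) + \<bar>b\<bar> powr (s - e))"
  proof (cases "\<bar>a\<bar> \<le> \<bar>b\<bar>")
    case True
    with *[of "\<bar>a\<bar>" "\<bar>b\<bar>"] show ?thesis by simp
  next
    case False
    with *[of "\<bar>b\<bar>" "\<bar>a\<bar>"] show ?thesis by (simp add: abs_minus_commute add.commute)
  qed
  also have "\<dots> \<le> \<bar>a - b\<bar> powr e * (\<bar>a\<bar> powr (s - e) + \<bar>b\<bar> powr (s - e))"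
    using d by (intro mult_right_mono) auto
  finally show "\<bar>\<bar>a\<bar> powr s - \<bar>b\<bar> powr s\<bar> \<le> \<bar>a - b\<bar> powr e * (\<bar>a\<bar> powr (s - e) + \<bar>b\<bar> powr (s - e))" .
qed

text \<open>For \<open>s < 1\<close> the maximum may be replaced by \<open>\<bar>b\<bar>\<close>, which makes the difference quotients at \<open>b\<close>
  dominated even when the derivative is unbounded.\<close>

lemma signed_powr_lipschitz:
  assumes s: "0 < s"
  shows "\<bar>signed_powr m s a - signed_powr m s b\<bar> \<le>
    2 * max 1 s * max \<bar>a\<bar> \<bar>b\<bar> powr (s - 1) * \<bar>a - b\<bar>"
proof (rule abs_signed_powr_diff_le)
  let ?M = "max \<bar>a\<bar> \<bar>b\<bar>"
  assume ab: "a * b < 0"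
  \<comment> \<open>Opposite signs make \<open>\<bar>a - b\<bar>\<close> at least the maximum; the
    factor 2 arises from bounding each of the two powers by that of the maximum.\<close>
  have le: "?M \<le> \<bar>a - b\<bar>" and M: "?M > 0" using ab by (auto simp: mult_less_0_iff)
  have "\<bar>a\<bar> powr s \<le> ?M powr s" "\<bar>b\<bar> powr s \<le> ?M powr s"
    using s by (auto intro!: powr_mono2)
  then have "\<bar>a\<bar> powr s + \<bar>b\<bar> powr s \<le> 2 * ?M powr (s - 1) * ?M"
    using M by (simp add: powr_diff)
  also have "\<dots> \<le> 2 * ?M powr (s - 1) * \<bar>a - b\<bar>"
    using le by (intro mult_left_mono) auto
  also have "\<dots> \<le> (2 * max 1 s) * ?M powr (s - 1) * \<bar>a - b\<bar>"
    by (intro mult_right_mono) auto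
  finally show "\<bar>a\<bar> powr s + \<bar>b\<bar> powr s \<le> 2 * max 1 s * ?M powr (s - 1) * \<bar>a - b\<bar>" .
next
  let ?M = "max \<bar>a\<bar> \<bar>b\<bar>"
  have *: "\<bar>x powr s - y powr s\<bar> \<le> max 1 s * y powr (s - 1) * (y - x)"
    if xy: "0 \<le> x" "x \<le> y" for x y
  proof (cases "x = 0 \<or> x = y")
    case True
    have "y powr s = y powr (s - 1) * y" if "y \<noteq> 0" using xy that by (simp add: powr_diff)
    moreover have "1 * (y powr (s - 1) * y) \<le> max 1 s * (y powr (s - 1) * y)"
      using xy by (intro mult_right_mono) auto
    moreover have "0 \<le> y powr (s - 1) * y" using xy by simp
    ultimately have "y powr s \<le> max 1 s * y powr (s - 1) * y" by (cases "y = 0") (simp_all add: mult.assoc)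
    then show ?thesis using True by auto
  next
    case False
    then have x: "0 < x" "x < y" and y: "0 < y" using xy by auto
    have "x powr s \<le> y powr s" using x s by (intro powr_mono2) auto
    then have abs: "\<bar>x powr s - y powr s\<bar> = y powr s - x powr s" by simp
    show ?thesis
    \<comment> \<open>The mean value theorem gives \<open>z powr (s - 1)\<close> at an intermediate
      \<open>z\<close>, which is controlled by the power at \<open>y\<close> only when the exponent
      is nonnegative. For \<open>s \<le> 1\<close> the inequality
      \<open>x / y \<le> (x / y) powr s\<close> takes its place.\<close>
    proof (cases "s \<le> 1")
      case True
      have "(x / y) powr 1 \<le> (x / y) powr s" using True x y by (intro powr_mono') auto
      then have "y powr s * (1 - (x / y) powr s) \<le> y powr s * (1 - x / y)"
        using x y by (intro mult_left_mono) auto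
      moreover have "y powr s * (1 - (x / y) powr s) = y powr s - x powr s"
        using x y by (simp add: powr_divide right_diff_distrib)
      moreover have "y powr s * (1 - x / y) = y powr (s - 1) * (y - x)"
        using y by (simp add: powr_diff field_simps)
      moreover have "max 1 s = 1" using True by simp
      ultimately show ?thesis using abs by simp
    next
      case False
      have "\<exists>z. x < z \<and> z < y \<and> y powr s - x powr s = (y - x) * (s * z powr (s - 1))"
        using x by (intro MVT2) (auto intro!: derivative_eq_intros)
      then obtain z where z: "x < z" "z < y" "y powr s - x powr s = (y - x) * (s * z powr (s - 1))"
        by blast
      have "(y - x) * (s * z powr (s - 1)) \<le> (y - x) * (s * y powr (s - 1))"
        using x z False by (intro mult_left_mono powr_mono2) auto
      moreover have "max 1 s = s" using False by simp
      ultimately show ?thesis using abs z by (simp add: mult_ac)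
    qed
  qed
  have "\<bar>\<bar>a\<bar> powr s - \<bar>b\<bar> powr s\<bar> \<le> max 1 s * ?M powr (s - 1) * \<bar>\<bar>a\<bar> - \<bar>b\<bar>\<bar>"
  proof (cases "\<bar>a\<bar> \<le> \<bar>b\<bar>")
    case True
    with *[of "\<bar>a\<bar>" "\<bar>b\<bar>"] show ?thesis by (simp add: max_absorb2)
  next
    case False
    with *[of "\<bar>b\<bar>" "\<bar>a\<bar>"] show ?thesis by (simp add: abs_minus_commute max_absorb1)
  qed
  also have "\<dots> \<le> (2 * max 1 s) * ?M powr (s - 1) * \<bar>a - b\<bar>"
    by (intro mult_mono) auto
  finally show "\<bar>\<bar>a\<bar> powr s - \<bar>b\<bar> powr s\<bar> \<le> 2 * max 1 s * ?M powr (s - 1) * \<bar>a - b\<bar>" .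
qed

section \<open>Ridge integrals\<close>

text \<open>A free weight \<open>g\<close> makes the family closed under directional derivatives,
  since the inner derivative \<open>e \<bullet> \<xi>\<close> can be absorbed into it.
  Non-integrable integrands would give the value 0, so integrability is shown separately in
  \<open>integrable_ridge\<close>.\<close>

definition ridge_integral :: "nat \<Rightarrow> real \<Rightarrow> ('a::euclidean_space \<Rightarrow> real) \<Rightarrow> 'a \<Rightarrow> real" where
  "ridge_integral m s g y = (\<integral>\<xi>. signed_powr m s (y \<bullet> \<xi>) * g \<xi> \<partial>spherical_lebesgue)"

lemma abs_inner_sphere_le:
  fixes y \<xi> :: "'a::euclidean_space"
  assumes "\<xi> \<in> space spherical_lebesgue"
  shows "\<bar>y \<bullet> \<xi>\<bar> \<le> norm y"
  using Cauchy_Schwarz_ineq2[of y \<xi>] assms by simp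

lemma integrable_powr_inner:
  fixes y :: "'a::euclidean_space"
  assumes "s > -1" "s \<ge> 0 \<or> y \<noteq> 0"
  shows "integrable spherical_lebesgue (\<lambda>\<xi>. \<bar>y \<bullet> \<xi>\<bar> powr s)"
proof (cases "s \<ge> 0")
  case True
  show ?thesis
  proof (rule finite_measure.integrable_const_bound[OF finite_measure_spherical_lebesgue])
    show "AE \<xi> in spherical_lebesgue. norm (\<bar>y \<bullet> \<xi>\<bar> powr s) \<le> norm y powr s"
      using True abs_inner_sphere_le by (auto intro!: AE_I2 powr_mono2)
  qed (auto intro!: borel_measurable_spherical_lebesgue)
next
  case False
  then obtain C where C: "\<And>y::'a. y \<noteq> 0 \<Longrightarrow>
      (\<integral>\<^sup>+\<xi>. ennreal (\<bar>y \<bullet> \<xi>\<bar> powr s) \<partial>spherical_lebesgue) \<le> ennreal (C * norm y powr s)"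
    using nn_integral_powr_inner_spherical_le[of s] assms(1) by (metis not_le)
  have "(\<integral>\<^sup>+\<xi>. ennreal (\<bar>y \<bullet> \<xi>\<bar> powr s) \<partial>spherical_lebesgue) < \<infinity>"
    using C[of y] assms False by (auto intro: le_less_trans)
  then show ?thesis
    by (intro integrableI_nonneg) (auto intro!: borel_measurable_spherical_lebesgue)
qed

lemma integral_powr_inner_le:
  assumes "-1 < s" "s < 0"
  obtains C where "C \<ge> 0" "\<And>y::'a::euclidean_space. y \<noteq> 0 \<Longrightarrow>
    (\<integral>\<xi>. \<bar>y \<bullet> \<xi>\<bar> powr s \<partial>spherical_lebesgue) \<le> C * norm y powr s"
proof -
  obtain C where C: "C \<ge> 0" "\<And>y::'a. y \<noteq> 0 \<Longrightarrow>
      (\<integral>\<^sup>+\<xi>. ennreal (\<bar>y \<bullet> \<xi>\<bar> powr s) \<partial>spherical_lebesgue) \<le> ennreal (C * norm y powr s)"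
    using nn_integral_powr_inner_spherical_le[OF assms] by blast
  have "(\<integral>\<xi>. \<bar>y \<bullet> \<xi>\<bar> powr s \<partial>spherical_lebesgue) \<le> C * norm y powr s" if "y \<noteq> 0" for y :: 'a
  proof -
    have "ennreal (\<integral>\<xi>. \<bar>y \<bullet> \<xi>\<bar> powr s \<partial>spherical_lebesgue) \<le> ennreal (C * norm y powr s)"
      using C(2)[OF that] integrable_powr_inner[of s y] that assms
      by (subst (asm) nn_integral_eq_integral) auto
    then show ?thesis using C(1) by (subst (asm) ennreal_le_iff) auto
  qed
  with C(1) that show ?thesis by blast
qed

lemma L_infinityE:
  assumes "g \<in> L_infinity M"
  obtains B where "B \<ge> 0" "AE x in M. \<bar>g x\<bar> \<le> B"
proof -
  obtain B where "AE x in M. \<bar>g x\<bar> \<le> B" using assms by (auto simp: L_infinity_def)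
  then have "AE x in M. \<bar>g x\<bar> \<le> max 0 B" by eventually_elim auto
  then show ?thesis using that[of "max 0 B"] by simp
qed

lemma L_infinity_measurable [measurable_dest]:
  "g \<in> L_infinity M \<Longrightarrow> g \<in> borel_measurable M"
  by (simp add: L_infinity_def)

text \<open>Keeps the weight admissible after a differentiation, so that derivatives can be
  iterated; the new factor is bounded on the sphere by Cauchy-Schwarz.\<close>

lemma L_infinity_inner_mult:
  fixes e :: "'a::euclidean_space"
  assumes g: "g \<in> L_infinity spherical_lebesgue"
  shows "(\<lambda>\<xi>. (e \<bullet> \<xi>) * g \<xi>) \<in> L_infinity spherical_lebesgue"
proof -
  obtain B where B: "B \<ge> 0" "AE \<xi> in spherical_lebesgue. \<bar>g \<xi>\<bar> \<le> B"
    using g by (rule L_infinityE)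
  from B(2) AE_space have "AE \<xi> in spherical_lebesgue. \<bar>(e \<bullet> \<xi>) * g \<xi>\<bar> \<le> norm e * B"
    by eventually_elim (auto simp: abs_mult intro!: mult_mono abs_inner_sphere_le)
  moreover have "(\<lambda>\<xi>. (e \<bullet> \<xi>) * g \<xi>) \<in> borel_measurable spherical_lebesgue"
    by (intro borel_measurable_times L_infinity_measurable[OF g]
        borel_measurable_spherical_lebesgue) measurable
  ultimately show ?thesis by (auto simp: L_infinity_def)
qed

lemma borel_measurable_ridge:
  fixes y :: "'a::euclidean_space"
  assumes "g \<in> L_infinity spherical_lebesgue"
  shows "(\<lambda>\<xi>. signed_powr m s (y \<bullet> \<xi>) * g \<xi>) \<in> borel_measurable spherical_lebesgue"
  by (intro borel_measurable_times borel_measurable_spherical_lebesgue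
      L_infinity_measurable[OF assms]) measurable

lemma integrable_ridge:
  fixes y :: "'a::euclidean_space"
  assumes "s > -1" "s \<ge> 0 \<or> y \<noteq> 0" "g \<in> L_infinity spherical_lebesgue"
  shows "integrable spherical_lebesgue (\<lambda>\<xi>. signed_powr m s (y \<bullet> \<xi>) * g \<xi>)"
proof -
  obtain B where B: "B \<ge> 0" "AE \<xi> in spherical_lebesgue. \<bar>g \<xi>\<bar> \<le> B"
    using assms(3) by (rule L_infinityE)
  show ?thesis
  proof (rule Bochner_Integration.integrable_bound)
    show "integrable spherical_lebesgue (\<lambda>\<xi>. B * \<bar>y \<bullet> \<xi>\<bar> powr s)"
      using integrable_powr_inner[OF assms(1,2)] by simp
    from B(2) show "AE \<xi> in spherical_lebesgue.
        norm (signed_powr m s (y \<bullet> \<xi>) * g \<xi>) \<le> norm (B * \<bar>y \<bullet> \<xi>\<bar> powr s)"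
      by eventually_elim (use B(1) in \<open>auto simp: abs_mult mult.commute intro!: mult_right_mono\<close>)
  qed (rule borel_measurable_ridge[OF assms(3)])
qed

text \<open>For \<open>s \<ge> 0\<close> the kernels are bounded along a convergent sequence and
  dominated convergence applies. For \<open>s < 0\<close> the singular hyperplane moves with
  \<open>u n\<close>, so the difference of the integrals is estimated directly by
  \<open>signed_powr_holder\<close>.\<close>

lemma continuous_on_ridge_integral:
  fixes g :: "'a::euclidean_space \<Rightarrow> real"
  assumes s: "s > -1" and g: "g \<in> L_infinity spherical_lebesgue"
  shows "continuous_on (- {0}) (ridge_integral m s g)"
proof (rule continuous_on_sequentiallyI)
  fix u :: "nat \<Rightarrow> 'a" and a
  assume u0: "\<forall>n. u n \<in> - {0}" and a0: "a \<in> - {0}" and lim: "u \<longlonglongrightarrow> a"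
  obtain B where B: "B \<ge> 0" "AE \<xi> in spherical_lebesgue. \<bar>g \<xi>\<bar> \<le> B"
    using g by (rule L_infinityE)
  show "(\<lambda>n. ridge_integral m s g (u n)) \<longlonglongrightarrow> ridge_integral m s g a"
  proof (cases "s \<ge> 0")
    case True
    have "Bseq u" using lim by (intro convergent_imp_Bseq) (auto simp: convergent_def)
    then obtain R where R: "\<And>n. norm (u n) \<le> R" by (auto simp: Bseq_def)
    show ?thesis unfolding ridge_integral_def
    proof (rule integral_dominated_convergence)
      show "integrable spherical_lebesgue (\<lambda>\<xi>::'a. R powr s * B)"
        using finite_measure.integrable_const[OF finite_measure_spherical_lebesgue] .
      \<comment> \<open>For \<open>s = 0\<close> the kernel is discontinuous at 0, so convergence is
        claimed only off the null set where \<open>a \<bullet> \<xi>\<close> vanishes.\<close>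
      have "AE \<xi> in spherical_lebesgue. a \<bullet> \<xi> \<noteq> 0"
        using a0 by (intro AE_spherical_lebesgue_inner_neq_0) auto
      then show "AE \<xi> in spherical_lebesgue. (\<lambda>n. signed_powr m s (u n \<bullet> \<xi>) * g \<xi>)
          \<longlonglongrightarrow> signed_powr m s (a \<bullet> \<xi>) * g \<xi>"
        by eventually_elim
          (intro tendsto_mult tendsto_const isCont_tendsto_compose[OF isCont_signed_powr]
            tendsto_inner lim)
      fix n
      from B(2) AE_space show "AE \<xi> in spherical_lebesgue.
          norm (signed_powr m s (u n \<bullet> \<xi>) * g \<xi>) \<le> R powr s * B"
      proof eventually_elim
        case (elim \<xi>)
        have "\<bar>u n \<bullet> \<xi>\<bar> \<le> R" using abs_inner_sphere_le[OF elim(2)] R by (rule order_trans)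
        then have "\<bar>u n \<bullet> \<xi>\<bar> powr s \<le> R powr s" using True by (intro powr_mono2) auto
        with elim show ?case by (auto simp: abs_mult intro!: mult_mono)
      qed
    qed (rule borel_measurable_ridge[OF g])+
  next
    case False
    \<comment> \<open>Half the distance from \<open>s\<close> to -1, so that \<open>s - e\<close> is
      the midpoint between them and the powers in the Hoelder bound remain integrable.\<close>
    define e where "e = (s + 1) / 2"
    have e: "0 < e" "e \<le> 1" "-1 < s - e" "s - e < 0"
      using s False by (auto simp: e_def field_simps)
    obtain C where C: "C \<ge> 0" "\<And>y::'a. y \<noteq> 0 \<Longrightarrow>
        (\<integral>\<xi>. \<bar>y \<bullet> \<xi>\<bar> powr (s - e) \<partial>spherical_lebesgue) \<le> C * norm y powr (s - e)"
      using integral_powr_inner_le[OF e(3,4)] by blast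
    let ?J = "\<lambda>y. \<integral>\<xi>. \<bar>y \<bullet> \<xi>\<bar> powr (s - e) \<partial>spherical_lebesgue"
    let ?w = "\<lambda>n. norm (u n - a) powr e * B * (C * norm (u n) powr (s - e) + C * norm a powr (s - e))"
    have bound: "\<bar>ridge_integral m s g (u n) - ridge_integral m s g a\<bar> \<le> ?w n" for n
    proof -
      have nz: "u n \<noteq> 0" "a \<noteq> 0" using u0 a0 by auto
      note [simp] = integrable_powr_inner[OF e(3)]
      have "ridge_integral m s g (u n) - ridge_integral m s g a =
          (\<integral>\<xi>. signed_powr m s (u n \<bullet> \<xi>) * g \<xi> - signed_powr m s (a \<bullet> \<xi>) * g \<xi> \<partial>spherical_lebesgue)"
        unfolding ridge_integral_def using nz s g
        by (intro Bochner_Integration.integral_diff[symmetric] integrable_ridge) auto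
      also have "\<bar>\<dots>\<bar> \<le> (\<integral>\<xi>. \<bar>signed_powr m s (u n \<bullet> \<xi>) * g \<xi> - signed_powr m s (a \<bullet> \<xi>) * g \<xi>\<bar>
          \<partial>spherical_lebesgue)"
        by (rule integral_abs_bound)
      also have "\<dots> \<le> (\<integral>\<xi>. norm (u n - a) powr e * B *
          (\<bar>u n \<bullet> \<xi>\<bar> powr (s - e) + \<bar>a \<bullet> \<xi>\<bar> powr (s - e)) \<partial>spherical_lebesgue)"
      proof (rule integral_mono_AE)
        show "integrable spherical_lebesgue
            (\<lambda>\<xi>. \<bar>signed_powr m s (u n \<bullet> \<xi>) * g \<xi> - signed_powr m s (a \<bullet> \<xi>) * g \<xi>\<bar>)"
          using nz s g
          by (intro integrable_abs Bochner_Integration.integrable_diff integrable_ridge) auto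
      next
        have pointwise: "\<bar>signed_powr m s (u n \<bullet> \<xi>) * g \<xi> - signed_powr m s (a \<bullet> \<xi>) * g \<xi>\<bar>
            \<le> norm (u n - a) powr e * B * (\<bar>u n \<bullet> \<xi>\<bar> powr (s - e) + \<bar>a \<bullet> \<xi>\<bar> powr (s - e))"
          if "\<xi> \<in> space spherical_lebesgue" "\<bar>g \<xi>\<bar> \<le> B" for \<xi>
        proof -
          have "\<bar>signed_powr m s (u n \<bullet> \<xi>) - signed_powr m s (a \<bullet> \<xi>)\<bar> \<le>
              \<bar>(u n - a) \<bullet> \<xi>\<bar> powr e * (\<bar>u n \<bullet> \<xi>\<bar> powr (s - e) + \<bar>a \<bullet> \<xi>\<bar> powr (s - e))"
            unfolding inner_diff_left using s False e by (intro signed_powr_holder) auto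
          also have "\<dots> \<le> norm (u n - a) powr e * (\<bar>u n \<bullet> \<xi>\<bar> powr (s - e) + \<bar>a \<bullet> \<xi>\<bar> powr (s - e))"
            using e abs_inner_sphere_le[OF that(1)] by (intro mult_right_mono powr_mono2) auto
          finally have "\<bar>signed_powr m s (u n \<bullet> \<xi>) - signed_powr m s (a \<bullet> \<xi>)\<bar> * \<bar>g \<xi>\<bar>
              \<le> (norm (u n - a) powr e * (\<bar>u n \<bullet> \<xi>\<bar> powr (s - e) + \<bar>a \<bullet> \<xi>\<bar> powr (s - e))) * B"
            using that by (intro mult_mono) auto
          then show ?thesis unfolding left_diff_distrib[symmetric] abs_mult by (simp add: mult_ac)
        qed
        from B(2) AE_space show "AE \<xi> in spherical_lebesgue.
            \<bar>signed_powr m s (u n \<bullet> \<xi>) * g \<xi> - signed_powr m s (a \<bullet> \<xi>) * g \<xi>\<bar>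
            \<le> norm (u n - a) powr e * B * (\<bar>u n \<bullet> \<xi>\<bar> powr (s - e) + \<bar>a \<bullet> \<xi>\<bar> powr (s - e))"
          by eventually_elim (rule pointwise)
      qed (use nz in auto)
      also have "\<dots> = norm (u n - a) powr e * B * (?J (u n) + ?J a)"
        using nz by simp
      also have "\<dots> \<le> ?w n"
        using nz B C by (intro mult_left_mono add_mono) auto
      finally show ?thesis .
    qed
    \<comment> \<open>Since \<open>a \<noteq> 0\<close>, the bracket has a finite limit, while the
      first factor tends to \<open>0 powr e = 0\<close>.\<close>
    have "?w \<longlonglongrightarrow> 0 powr e * B * (C * norm a powr (s - e) + C * norm a powr (s - e))"
      using a0 e
      by (intro tendsto_mult tendsto_add tendsto_const tendsto_powr' tendsto_norm lim
          tendsto_norm_zero LIM_zero) auto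
    then have "?w \<longlonglongrightarrow> 0" using e by simp
    then have "(\<lambda>n. ridge_integral m s g (u n) - ridge_integral m s g a) \<longlonglongrightarrow> 0"
      by (rule Lim_null_comparison[rotated]) (use bound in auto)
    then show ?thesis by (rule LIM_zero_cancel)
  qed
qed

text \<open>Dominated convergence for the difference quotients along an arbitrary null sequence.
  They converge pointwise off the null set \<open>x \<bullet> \<xi> = 0\<close>, and
  \<open>signed_powr_lipschitz\<close> dominates them even when \<open>s - 1\<close> is
  negative.\<close>

lemma has_real_derivative_ridge_integral:
  fixes g :: "'a::euclidean_space \<Rightarrow> real"
  assumes s: "s > 0" and g: "g \<in> L_infinity spherical_lebesgue" and x: "x \<noteq> 0"
  shows "((\<lambda>t. ridge_integral m s g (x + t *\<^sub>R e)) has_real_derivative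
    s * ridge_integral (Suc m) (s - 1) (\<lambda>\<xi>. (e \<bullet> \<xi>) * g \<xi>) x) (at 0)"
  unfolding DERIV_def tendsto_at_iff_sequentially
proof (intro allI impI, unfold o_def)
  fix h :: "nat \<Rightarrow> real"
  assume "\<forall>i. h i \<in> UNIV - {0}" and h: "h \<longlonglongrightarrow> 0"
  then have h0: "h i \<noteq> 0" for i by auto
  obtain B where B: "B \<ge> 0" "AE \<xi> in spherical_lebesgue. \<bar>g \<xi>\<bar> \<le> B"
    using g by (rule L_infinityE)
  have "Bseq h" using h by (intro convergent_imp_Bseq) (auto simp: convergent_def)
  then obtain R where R: "\<And>n. \<bar>h n\<bar> \<le> R" by (auto simp: Bseq_def)
  have nz: "AE \<xi> in spherical_lebesgue. x \<bullet> \<xi> \<noteq> 0"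
    using x by (rule AE_spherical_lebesgue_inner_neq_0)
  let ?M = "\<lambda>n \<xi>. max \<bar>(x + h n *\<^sub>R e) \<bullet> \<xi>\<bar> \<bar>x \<bullet> \<xi>\<bar>"
  let ?Q = "\<lambda>n \<xi>. (signed_powr m s ((x + h n *\<^sub>R e) \<bullet> \<xi>) * g \<xi> - signed_powr m s (x \<bullet> \<xi>) * g \<xi>) / h n"
  \<comment> \<open>If \<open>s < 1\<close>, the exponent is negative and the maximum is at least
    \<open>\<bar>x \<bullet> \<xi>\<bar>\<close>, so the singularity of the bound stays on one
    hyperplane, whatever \<open>n\<close> is. Otherwise the maximum itself is bounded, because
    \<open>h\<close> is.\<close>
  obtain v where v: "integrable spherical_lebesgue v"
    "\<And>n. AE \<xi> in spherical_lebesgue. ?M n \<xi> powr (s - 1) \<le> v \<xi>"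
  proof (cases "s < 1")
    case True
    show ?thesis
    proof
      show "integrable spherical_lebesgue (\<lambda>\<xi>. \<bar>x \<bullet> \<xi>\<bar> powr (s - 1))"
        using s x by (intro integrable_powr_inner) auto
      show "AE \<xi> in spherical_lebesgue. ?M n \<xi> powr (s - 1) \<le> \<bar>x \<bullet> \<xi>\<bar> powr (s - 1)" for n
        using nz by eventually_elim (use True in \<open>intro powr_mono2'; auto\<close>)
    qed
  next
    case False
    show ?thesis
    proof
      show "integrable spherical_lebesgue (\<lambda>\<xi>::'a. (norm x + R * norm e) powr (s - 1))"
        using finite_measure.integrable_const[OF finite_measure_spherical_lebesgue] .
      show "AE \<xi> in spherical_lebesgue. ?M n \<xi> powr (s - 1) \<le> (norm x + R * norm e) powr (s - 1)" for n
      proof (intro AE_I2 powr_mono2)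
        fix \<xi> :: 'a assume \<xi>: "\<xi> \<in> space spherical_lebesgue"
        have "norm (x + h n *\<^sub>R e) \<le> norm x + \<bar>h n\<bar> * norm e"
          using norm_triangle_ineq[of x "h n *\<^sub>R e"] by simp
        also have "\<dots> \<le> norm x + R * norm e"
          using R by (intro add_left_mono mult_right_mono) auto
        finally have "\<bar>(x + h n *\<^sub>R e) \<bullet> \<xi>\<bar> \<le> norm x + R * norm e"
          using abs_inner_sphere_le[OF \<xi>] by (rule order_trans[rotated])
        moreover have "0 \<le> R * norm e" using R[of 0] by simp
        then have "\<bar>x \<bullet> \<xi>\<bar> \<le> norm x + R * norm e"
          using abs_inner_sphere_le[OF \<xi>, of x] by linarith
        ultimately show "?M n \<xi> \<le> norm x + R * norm e" by simp
      qed (use False in auto)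
    qed
  qed
  have "(\<lambda>n. \<integral>\<xi>. ?Q n \<xi> \<partial>spherical_lebesgue) \<longlonglongrightarrow>
      (\<integral>\<xi>. s * (signed_powr (Suc m) (s - 1) (x \<bullet> \<xi>) * ((e \<bullet> \<xi>) * g \<xi>)) \<partial>spherical_lebesgue)"
  proof (rule integral_dominated_convergence)
    show "integrable spherical_lebesgue (\<lambda>\<xi>. 2 * max 1 s * norm e * B * v \<xi>)"
      using v by simp
    show "(\<lambda>\<xi>. s * (signed_powr (Suc m) (s - 1) (x \<bullet> \<xi>) * ((e \<bullet> \<xi>) * g \<xi>)))
        \<in> borel_measurable spherical_lebesgue"
      by (intro borel_measurable_times borel_measurable_const borel_measurable_ridge
          L_infinity_inner_mult g)
    show "?Q n \<in> borel_measurable spherical_lebesgue" for n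
      by (intro borel_measurable_divide borel_measurable_const borel_measurable_diff
          borel_measurable_ridge g)
    from nz show "AE \<xi> in spherical_lebesgue. (\<lambda>n. ?Q n \<xi>) \<longlonglongrightarrow>
        s * (signed_powr (Suc m) (s - 1) (x \<bullet> \<xi>) * ((e \<bullet> \<xi>) * g \<xi>))"
    proof eventually_elim
      case (elim \<xi>)
      have "((\<lambda>t. x \<bullet> \<xi> + t * (e \<bullet> \<xi>)) has_real_derivative e \<bullet> \<xi>) (at 0)"
        by (auto intro!: derivative_eq_intros)
      from DERIV_chain2[OF _ this, of "signed_powr m s"] elim
      have "((\<lambda>t. signed_powr m s (x \<bullet> \<xi> + t * (e \<bullet> \<xi>))) has_real_derivative
          s * signed_powr (Suc m) (s - 1) (x \<bullet> \<xi>) * (e \<bullet> \<xi>)) (at 0)"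
        by (simp add: has_real_derivative_signed_powr)
      from DERIV_mult[OF this DERIV_const[of "g \<xi>"]]
      have "((\<lambda>t. signed_powr m s (x \<bullet> \<xi> + t * (e \<bullet> \<xi>)) * g \<xi>) has_real_derivative
          s * signed_powr (Suc m) (s - 1) (x \<bullet> \<xi>) * (e \<bullet> \<xi>) * g \<xi>) (at 0)"
        by simp
      then have "((\<lambda>t. (signed_powr m s ((x + t *\<^sub>R e) \<bullet> \<xi>) * g \<xi> - signed_powr m s (x \<bullet> \<xi>) * g \<xi>) / t)
          \<longlongrightarrow> s * (signed_powr (Suc m) (s - 1) (x \<bullet> \<xi>) * ((e \<bullet> \<xi>) * g \<xi>))) (at 0)"
        by (simp add: DERIV_def inner_add_left mult_ac)
      then show ?case
        using h h0 unfolding tendsto_at_iff_sequentially by (auto simp: o_def)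
    qed
    fix n
    from v(2)[of n] B(2) AE_space
    show "AE \<xi> in spherical_lebesgue. norm (?Q n \<xi>) \<le> 2 * max 1 s * norm e * B * v \<xi>"
    proof eventually_elim
      case (elim \<xi>)
      have "\<bar>signed_powr m s ((x + h n *\<^sub>R e) \<bullet> \<xi>) - signed_powr m s (x \<bullet> \<xi>)\<bar>
          \<le> 2 * max 1 s * ?M n \<xi> powr (s - 1) * \<bar>(x + h n *\<^sub>R e) \<bullet> \<xi> - x \<bullet> \<xi>\<bar>"
        using s by (rule signed_powr_lipschitz)
      also have "\<bar>(x + h n *\<^sub>R e) \<bullet> \<xi> - x \<bullet> \<xi>\<bar> = \<bar>h n\<bar> * \<bar>e \<bullet> \<xi>\<bar>"
        by (simp add: inner_add_left abs_mult)
      also have "2 * max 1 s * ?M n \<xi> powr (s - 1) * (\<bar>h n\<bar> * \<bar>e \<bullet> \<xi>\<bar>)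
          \<le> 2 * max 1 s * v \<xi> * (\<bar>h n\<bar> * norm e)"
        using elim abs_inner_sphere_le[OF elim(3), of e] order_trans[OF powr_ge_zero elim(1)]
        by (intro mult_mono) auto
      finally have "\<bar>signed_powr m s ((x + h n *\<^sub>R e) \<bullet> \<xi>) - signed_powr m s (x \<bullet> \<xi>)\<bar> * \<bar>g \<xi>\<bar>
          \<le> (2 * max 1 s * v \<xi> * (\<bar>h n\<bar> * norm e)) * B"
        using elim B(1) order_trans[OF powr_ge_zero elim(1)] by (intro mult_mono) auto
      then have "\<bar>signed_powr m s ((x + h n *\<^sub>R e) \<bullet> \<xi>) * g \<xi> - signed_powr m s (x \<bullet> \<xi>) * g \<xi>\<bar>
          \<le> (2 * max 1 s * norm e * B * v \<xi>) * \<bar>h n\<bar>"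
        unfolding left_diff_distrib[symmetric] abs_mult by (simp add: mult_ac)
      then show ?case using h0[of n] by (simp add: pos_divide_le_eq)
    qed
  qed
  also have "(\<lambda>n. \<integral>\<xi>. ?Q n \<xi> \<partial>spherical_lebesgue) =
      (\<lambda>n. (ridge_integral m s g (x + h n *\<^sub>R e) - ridge_integral m s g x) / h n)"
    unfolding ridge_integral_def using s g
    by (simp add: integrable_ridge)
  finally show "(\<lambda>n. (ridge_integral m s g (x + (0 + h n) *\<^sub>R e) - ridge_integral m s g (x + 0 *\<^sub>R e)) / h n)
      \<longlonglongrightarrow> s * ridge_integral (Suc m) (s - 1) (\<lambda>\<xi>. (e \<bullet> \<xi>) * g \<xi>) x"
    by (simp add: ridge_integral_def)
qed

section \<open>Partial derivatives\<close>

text \<open>Near 0 the coordinate line through \<open>x\<close> stays in the open set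
  \<open>S\<close>, so only values on \<open>S\<close> enter. This matters because the formulas for
  derivatives are known only away from the origin.\<close>

lemma partial_deriv_cong:
  fixes F G :: "real^'n::finite \<Rightarrow> real"
  assumes "open S" "x \<in> S" "\<And>y. y \<in> S \<Longrightarrow> F y = G y"
  shows "partial_deriv j F x = partial_deriv j G x"
    and "(\<lambda>t. F (x + t *\<^sub>R axis j 1)) field_differentiable (at (0::real)) \<longleftrightarrow>
      (\<lambda>t. G (x + t *\<^sub>R axis j 1)) field_differentiable (at 0)"
proof -
  have "((\<lambda>t::real. x + t *\<^sub>R axis j 1) \<longlongrightarrow> x + 0 *\<^sub>R axis j 1) (nhds 0)"
    by (intro tendsto_intros) (rule filterlim_ident)
  then have "\<forall>\<^sub>F t in nhds (0::real). x + t *\<^sub>R axis j 1 \<in> S"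
    using assms by (intro topological_tendstoD) auto
  then have ev: "\<forall>\<^sub>F t in nhds (0::real). F (x + t *\<^sub>R axis j 1) = G (x + t *\<^sub>R axis j 1)"
    by eventually_elim (rule assms(3))
  show "partial_deriv j F x = partial_deriv j G x"
    unfolding partial_deriv_def by (rule deriv_cong_ev[OF ev refl])
  show "(\<lambda>t. F (x + t *\<^sub>R axis j 1)) field_differentiable (at (0::real)) \<longleftrightarrow>
      (\<lambda>t. G (x + t *\<^sub>R axis j 1)) field_differentiable (at 0)"
    unfolding field_differentiable_def by (simp add: DERIV_cong_ev[OF refl ev refl])
qed

lemma C_k_on_cong:
  assumes "open S" "\<And>x. x \<in> S \<Longrightarrow> F x = G x"
  shows "C_k_on k F S \<longleftrightarrow> C_k_on k G S"
  using assms(2)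
proof (induction k arbitrary: F G)
  case 0
  then show ?case by (simp cong: continuous_on_cong)
next
  case (Suc k)
  have "C_k_on k (partial_deriv j F) S \<longleftrightarrow> C_k_on k (partial_deriv j G) S" for j
    using partial_deriv_cong(1)[OF assms(1) _ Suc.prems] by (intro Suc.IH) auto
  moreover have "(\<forall>x\<in>S. (\<lambda>t. F (x + t *\<^sub>R axis j 1)) field_differentiable (at (0::real))) \<longleftrightarrow>
      (\<forall>x\<in>S. (\<lambda>t. G (x + t *\<^sub>R axis j 1)) field_differentiable (at (0::real)))" for j
    using Suc.prems
    by (intro ball_cong refl partial_deriv_cong(2)[where F = F and G = G and S = S] assms(1)) auto
  ultimately show ?case using Suc.prems by (simp cong: continuous_on_cong)
qed

text \<open>The \<open>m\<close>-th derivative of \<open>\<bar>t\<bar> powr p\<close> is \<open>(\<Prod>i<m. p - real i) * signed_powr m (p - real m) t\<close>.\<close>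

definition ridge_deriv :: "real \<Rightarrow> nat \<Rightarrow> ('a::euclidean_space \<Rightarrow> real) \<Rightarrow> 'a \<Rightarrow> real" where
  "ridge_deriv p m g y = (\<Prod>i<m. p - real i) * ridge_integral m (p - real m) g y"

lemma ridge_deriv_has_partial_deriv:
  fixes g :: "real^'n::finite \<Rightarrow> real"
  assumes "real m < p" "g \<in> L_infinity spherical_lebesgue" "x \<noteq> 0"
  shows "((\<lambda>t. ridge_deriv p m g (x + t *\<^sub>R axis j 1)) has_real_derivative
    ridge_deriv p (Suc m) (\<lambda>\<xi>. \<xi> $ j * g \<xi>) x) (at 0)"
proof -
  have "((\<lambda>t. ridge_integral m (p - real m) g (x + t *\<^sub>R axis j 1)) has_real_derivative
      (p - real m) * ridge_integral (Suc m) (p - real (Suc m)) (\<lambda>\<xi>. \<xi> $ j * g \<xi>) x) (at 0)"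
    using has_real_derivative_ridge_integral[of "p - real m" g x m "axis j 1"] assms
    by (simp add: inner_axis' diff_diff_eq add.commute)
  from DERIV_cmult[OF this, of "\<Prod>i<m. p - real i"] show ?thesis
    by (simp add: ridge_deriv_def mult.assoc)
qed

lemma L_infinity_component_mult:
  fixes g :: "real^'n::finite \<Rightarrow> real"
  assumes "g \<in> L_infinity spherical_lebesgue"
  shows "(\<lambda>\<xi>. \<xi> $ j * g \<xi>) \<in> L_infinity spherical_lebesgue"
  using L_infinity_inner_mult[OF assms, of "axis j 1"] by (simp add: inner_axis')

text \<open>The bound on \<open>m + k\<close> keeps the exponent positive before every
  differentiation, as differentiability requires. Only after the last one may it fall into
  \<open>(-1, 0]\<close>, where continuity is all that is claimed.\<close>

lemma C_k_on_ridge_deriv: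
  fixes g :: "real^'n::finite \<Rightarrow> real"
  assumes "real m + real k < p + 1" "g \<in> L_infinity spherical_lebesgue"
  shows "C_k_on k (ridge_deriv p m g) (UNIV - {0})"
  using assms
proof (induction k arbitrary: m g)
  case 0
  then show ?case
    unfolding ridge_deriv_def C_k_on.simps Compl_eq_Diff_UNIV[symmetric]
    by (intro continuous_on_mult continuous_on_const continuous_on_ridge_integral) auto
next
  case (Suc k)
  have "continuous_on (UNIV - {0}) (ridge_deriv p m g)"
    unfolding ridge_deriv_def Compl_eq_Diff_UNIV[symmetric] using Suc.prems
    by (intro continuous_on_mult continuous_on_const continuous_on_ridge_integral) auto
  moreover have d: "((\<lambda>t. ridge_deriv p m g (x + t *\<^sub>R axis j 1)) has_real_derivative
      ridge_deriv p (Suc m) (\<lambda>\<xi>. \<xi> $ j * g \<xi>) x) (at 0)" if "x \<noteq> 0" for x j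
    using Suc.prems that by (intro ridge_deriv_has_partial_deriv) auto
  moreover have "C_k_on k (partial_deriv j (ridge_deriv p m g)) (UNIV - {0})" for j
  proof (subst C_k_on_cong)
    show "C_k_on k (ridge_deriv p (Suc m) (\<lambda>\<xi>. \<xi> $ j * g \<xi>)) (UNIV - {0})"
      using Suc.prems by (intro Suc.IH L_infinity_component_mult) auto
    show "partial_deriv j (ridge_deriv p m g) x = ridge_deriv p (Suc m) (\<lambda>\<xi>. \<xi> $ j * g \<xi>) x"
      if "x \<in> UNIV - {0}" for x
      using d[of x j] that by (auto simp: partial_deriv_def intro!: DERIV_imp_deriv)
  qed auto
  ultimately show ?case
    by (auto simp: field_differentiable_def)
qed

lemma partial_deriv_ridge_deriv:
  fixes F g :: "real^'n::finite \<Rightarrow> real"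
  assumes "real m < p" "g \<in> L_infinity spherical_lebesgue" "x \<noteq> 0"
    and "\<And>y. y \<noteq> 0 \<Longrightarrow> F y = ridge_deriv p m g y"
  shows "partial_deriv j F x = ridge_deriv p (Suc m) (\<lambda>\<xi>. \<xi> $ j * g \<xi>) x"
proof -
  have "partial_deriv j F x = partial_deriv j (ridge_deriv p m g) x"
    using assms by (intro partial_deriv_cong(1)[of "- {0}"]) auto
  also have "\<dots> = ridge_deriv p (Suc m) (\<lambda>\<xi>. \<xi> $ j * g \<xi>) x"
    unfolding partial_deriv_def
    using ridge_deriv_has_partial_deriv[OF assms(1-3)] by (rule DERIV_imp_deriv)
  finally show ?thesis .
qed

text \<open>Boundedness of the weight is carried through the induction together with the formula,
  because the next derivative requires it.\<close>

lemma partial_deriv_funpow_ridge_deriv: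
  fixes F g :: "real^'n::finite \<Rightarrow> real"
  assumes "real (m + k) < p + 1" "g \<in> L_infinity spherical_lebesgue"
    and "\<And>y. y \<noteq> 0 \<Longrightarrow> F y = ridge_deriv p m g y"
  shows "(\<lambda>\<xi>. (\<xi> $ j) ^ k * g \<xi>) \<in> L_infinity spherical_lebesgue \<and> (\<forall>x. x \<noteq> 0 \<longrightarrow>
    (partial_deriv j ^^ k) F x = ridge_deriv p (m + k) (\<lambda>\<xi>. (\<xi> $ j) ^ k * g \<xi>) x)"
  using assms(1)
proof (induction k)
  case 0
  then show ?case using assms by simp
next
  case (Suc k)
  then have IH: "(\<lambda>\<xi>. (\<xi> $ j) ^ k * g \<xi>) \<in> L_infinity spherical_lebesgue"
    "\<And>x. x \<noteq> 0 \<Longrightarrow> (partial_deriv j ^^ k) F x = ridge_deriv p (m + k) (\<lambda>\<xi>. (\<xi> $ j) ^ k * g \<xi>) x"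
    by auto
  have "real (m + k) < p" using Suc.prems by simp
  from partial_deriv_ridge_deriv[OF this IH(1) _ IH(2)] L_infinity_component_mult[OF IH(1), of j]
  show ?case by (simp add: mult.assoc)
qed

text \<open>\<open>foldr\<close> applies the head of the list last, so the tail supplies the
  function, the order already reached and the bounded weight for
  \<open>partial_deriv_funpow_ridge_deriv\<close>.\<close>

lemma foldr_partial_deriv_ridge_deriv:
  fixes F g :: "real^'n::finite \<Rightarrow> real"
  assumes "real (\<Sum>j\<leftarrow>js. \<alpha> j) < p + 1" "g \<in> L_infinity spherical_lebesgue"
    and "\<And>y. y \<noteq> 0 \<Longrightarrow> F y = ridge_deriv p 0 g y"
  shows "(\<lambda>\<xi>. (\<Prod>j\<leftarrow>js. (\<xi> $ j) ^ \<alpha> j) * g \<xi>) \<in> L_infinity spherical_lebesgue \<and> (\<forall>x. x \<noteq> 0 \<longrightarrow>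
    foldr (\<lambda>j. partial_deriv j ^^ \<alpha> j) js F x =
      ridge_deriv p (\<Sum>j\<leftarrow>js. \<alpha> j) (\<lambda>\<xi>. (\<Prod>j\<leftarrow>js. (\<xi> $ j) ^ \<alpha> j) * g \<xi>) x)"
  using assms(1)
proof (induction js)
  case Nil
  then show ?case using assms by simp
next
  case (Cons j js)
  then have IH: "(\<lambda>\<xi>. (\<Prod>j\<leftarrow>js. (\<xi> $ j) ^ \<alpha> j) * g \<xi>) \<in> L_infinity spherical_lebesgue"
    "\<And>x. x \<noteq> 0 \<Longrightarrow> foldr (\<lambda>j. partial_deriv j ^^ \<alpha> j) js F x =
      ridge_deriv p (\<Sum>j\<leftarrow>js. \<alpha> j) (\<lambda>\<xi>. (\<Prod>j\<leftarrow>js. (\<xi> $ j) ^ \<alpha> j) * g \<xi>) x"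
    by auto
  have "real ((\<Sum>j\<leftarrow>js. \<alpha> j) + \<alpha> j) < p + 1" using Cons.prems by simp
  from partial_deriv_funpow_ridge_deriv[OF this IH] show ?case
    by (simp add: mult.assoc add.commute)
qed

section \<open>The constants\<close>

text \<open>\<open>Gamma\<close> takes the value 0 exactly at the nonpositive integers, its poles.
  This lemma thus makes the denominator of \<open>C_const t\<close> nonzero.\<close>

lemma minus_half_notin_nonpos_Ints:
  fixes t :: real
  assumes "\<not> (\<exists>k::int. even k \<and> t = of_int k)"
  shows "- t / 2 \<notin> \<int>\<^sub>\<le>\<^sub>0"
proof
  assume "- t / 2 \<in> \<int>\<^sub>\<le>\<^sub>0"
  then obtain k where "- t / 2 = of_int k" by (auto elim!: nonpos_Ints_cases)
  then have "t = of_int (- 2 * k)" by simp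
  then show False using assms by (metis even_mult_iff even_minus even_numeral)
qed

text \<open>The functional equation of \<open>Gamma\<close> contributes \<open>(t - 1) / 2\<close>
  from the numerator and \<open>- t / 2\<close> from the denominator; the power of 2 contributes the
  factor 4.\<close>

lemma C_const_rec:
  assumes "t > 1" "\<not> (\<exists>k::int. even k \<and> t = of_int k)"
  shows "C_const t = - (t * (t - 1)) * C_const (t - 2)"
proof -
  have "Gamma ((t - 1) / 2 + 1) = (t - 1) / 2 * Gamma ((t - 1) / 2)"
    using assms by (intro Gamma_plus1) (auto elim!: nonpos_Ints_cases)
  then have 1: "Gamma ((t + 1) / 2) = (t - 1) / 2 * Gamma ((t - 1) / 2)"
    by (simp add: field_simps)
  note nz = minus_half_notin_nonpos_Ints[OF assms(2)]
  have "Gamma (- t / 2 + 1) = - t / 2 * Gamma (- t / 2)"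
    using nz by (rule Gamma_plus1)
  then have 2: "Gamma (- (t - 2) / 2) = - t / 2 * Gamma (- t / 2)"
    by (simp add: field_simps)
  have "2 powr (t + 1) = 2 powr ((t - 1) + 2)" by (simp add: add.commute)
  also have "\<dots> = 4 * 2 powr (t - 1)" by (subst powr_add) simp
  finally have 3: "2 powr (t + 1) = 4 * 2 powr (t - 1)" .
  have "Gamma (- t / 2) \<noteq> 0" using nz by (simp add: Gamma_eq_zero_iff)
  then show ?thesis
    using assms(1) unfolding C_const_def 1 2 3 by (simp add: field_simps)
qed

lemma C_const_nonzero:
  assumes "t > -1" "\<not> (\<exists>k::int. even k \<and> t = of_int k)"
  shows "C_const t \<noteq> 0"
proof -
  have "Gamma (- t / 2) \<noteq> 0"
    using minus_half_notin_nonpos_Ints[OF assms(2)] by (simp only: Gamma_eq_zero_iff not_False_eq_True)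
  moreover have "Gamma ((t + 1) / 2) \<noteq> 0"
    using assms by (intro less_imp_neq[symmetric] Gamma_real_pos) auto
  ultimately show ?thesis unfolding C_const_def by simp
qed

text \<open>Iterating \<open>C_const_rec\<close>, each step of size 2 supplies one sign and two
  consecutive factors of the falling product. The recursion starts from exponents above 1, so the
  final one may be negative but exceeds -1.\<close>

lemma C_const_quotient:
  assumes "p - 2 * real k > -1" "\<not> (\<exists>k::int. even k \<and> p = of_int k)"
  shows "C_const p / C_const (p - 2 * real k) = (-1) ^ k * (\<Prod>i<2 * k. p - real i)"
proof -
  \<comment> \<open>Subtracting an even integer from \<open>p\<close> cannot produce an even
    integer, so the recursion and the nonvanishing apply at every stage.\<close>
  have ne: "\<not> (\<exists>i::int. even i \<and> p - 2 * real j = of_int i)" for j :: nat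
  proof
    assume "\<exists>i::int. even i \<and> p - 2 * real j = of_int i"
    then obtain i :: int where "even i" "p = of_int (i + 2 * int j)" by (auto simp: algebra_simps)
    then show False using assms(2) by (metis dvd_add_times_triv_right_iff even_add even_mult_iff even_numeral)
  qed
  have "C_const p = (-1) ^ k * (\<Prod>i<2 * k. p - real i) * C_const (p - 2 * real k)"
    using assms(1)
  proof (induction k)
    case (Suc k)
    then have t: "p - 2 * real k > 1" by simp
    have "C_const p = (-1) ^ k * (\<Prod>i<2 * k. p - real i) * C_const (p - 2 * real k)"
      using Suc t by simp
    also have "C_const (p - 2 * real k) =
        - ((p - 2 * real k) * (p - 2 * real k - 1)) * C_const (p - 2 * real (Suc k))"
      using C_const_rec[OF t ne] by (simp add: algebra_simps)
    finally show ?case by (simp add: algebra_simps)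
  qed simp
  then show ?thesis using C_const_nonzero[OF assms(1) ne] by simp
qed

section \<open>Differentiation of \<open>H\<close> to even order\<close>

theorem theorem2p2:
  fixes p :: real and f H :: "real^'n::{finite,linorder} \<Rightarrow> real" and \<alpha> :: "'n \<Rightarrow> nat"
  assumes "CARD('n) \<ge> 2"
    and "p > 1" and "\<not> (\<exists>k::int. even k \<and> p = of_int k)"
    and "f \<in> L_infinity spherical_lebesgue"
    and "\<And>x. H x = (\<integral>\<xi>. \<bar>x \<bullet> \<xi>\<bar> powr p * f \<xi> \<partial>spherical_lebesgue)"
    and "even (\<Sum>j\<in>UNIV. \<alpha> j)" and "real (\<Sum>j\<in>UNIV. \<alpha> j) < p + 1"
  shows "C_k_on (\<Sum>j\<in>UNIV. \<alpha> j) H (UNIV - {0}) \<and>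
    (\<forall>x. x \<noteq> 0 \<longrightarrow>
      integrable spherical_lebesgue
        (\<lambda>\<xi>. \<bar>x \<bullet> \<xi>\<bar> powr (p - real (\<Sum>j\<in>UNIV. \<alpha> j)) * (\<Prod>j\<in>UNIV. (\<xi> $ j) ^ \<alpha> j) * f \<xi>) \<and>
      complex_of_real (multi_deriv \<alpha> H x) =
        \<i> ^ (\<Sum>j\<in>UNIV. \<alpha> j) *
        complex_of_real (C_const p / C_const (p - real (\<Sum>j\<in>UNIV. \<alpha> j))) *
        complex_of_real (\<integral>\<xi>. \<bar>x \<bullet> \<xi>\<bar> powr (p - real (\<Sum>j\<in>UNIV. \<alpha> j)) *
           (\<Prod>j\<in>UNIV. (\<xi> $ j) ^ \<alpha> j) * f \<xi> \<partial>spherical_lebesgue))"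
proof -
  define M where "M = (\<Sum>j\<in>UNIV. \<alpha> j)"
  obtain k where k: "M = 2 * k" using assms(6) by (auto simp: M_def)
  have M: "real M < p + 1" using assms(7) by (simp add: M_def)
  define js where "js = sorted_list_of_set (UNIV :: 'n set)"
  have js: "distinct js" "set js = UNIV" by (simp_all add: js_def)
  have sum: "(\<Sum>j\<leftarrow>js. \<alpha> j) = M"
    using sum_list_distinct_conv_sum_set[OF js(1), of \<alpha>] js by (simp add: M_def)
  have prod: "(\<Prod>j\<leftarrow>js. (\<xi> $ j) ^ \<alpha> j) = (\<Prod>j\<in>UNIV. (\<xi> $ j) ^ \<alpha> j)" for \<xi> :: "real^'n::{finite,linorder}"
    using prod.distinct_set_conv_list[OF js(1), of "\<lambda>j. (\<xi> $ j) ^ \<alpha> j"] js by simp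
  let ?g = "\<lambda>\<xi>::real^'n::{finite,linorder}. (\<Prod>j\<in>UNIV. (\<xi> $ j) ^ \<alpha> j) * f \<xi>"
  have H: "H = ridge_deriv p 0 f"
    using assms(5) by (auto simp: ridge_deriv_def ridge_integral_def signed_powr_def)
  \<comment> \<open>As \<open>M\<close> is even, the sign factor is 1 for
    \<open>t \<noteq> 0\<close>; at \<open>t = 0\<close> both sides are 0 by the convention for
    \<open>powr\<close>.\<close>
  have even_powr: "signed_powr M s t = \<bar>t\<bar> powr s" for s t
    by (cases "t = 0") (auto simp: signed_powr_def k power_mult power2_eq_square abs_sgn_eq
        simp flip: sgn_mult intro!: power_one)
  have "real (\<Sum>j\<leftarrow>js. \<alpha> j) < p + 1" using M sum by simp
  from foldr_partial_deriv_ridge_deriv[OF this assms(4), of H]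
  have g: "?g \<in> L_infinity spherical_lebesgue"
    and deriv: "multi_deriv \<alpha> H x = ridge_deriv p M ?g x" if "x \<noteq> 0" for x
    unfolding sum prod using H that by (auto simp: multi_deriv_def js_def)
  have const: "\<i> ^ M * complex_of_real (C_const p / C_const (p - real M)) =
      complex_of_real (\<Prod>i<M. p - real i)"
  \<comment> \<open>With \<open>M = 2 * k\<close>, the sign \<open>(-1) ^ k\<close> occurs once in
    the power of \<open>\<i>\<close> and once in the quotient of the constants, and the two
    cancel.\<close>
  proof -
    have "C_const p / C_const (p - real M) = (-1) ^ k * (\<Prod>i<M. p - real i)"
      using C_const_quotient[of p k] M assms(3) by (simp add: k)
    moreover have "\<i> ^ M = complex_of_real ((-1) ^ k)" by (simp add: k power_mult)
    moreover have "(-1 :: real) ^ k * (-1) ^ k = 1" by (simp flip: power_mult_distrib)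
    ultimately show ?thesis by (metis of_real_mult mult.assoc mult_1)
  qed
  have "C_k_on M H (UNIV - {0})"
    unfolding H using M assms(4) by (intro C_k_on_ridge_deriv) auto
  moreover have "integrable spherical_lebesgue
      (\<lambda>\<xi>. \<bar>x \<bullet> \<xi>\<bar> powr (p - real M) * (\<Prod>j\<in>UNIV. (\<xi> $ j) ^ \<alpha> j) * f \<xi>)" if "x \<noteq> 0" for x
    using integrable_ridge[of "p - real M" x ?g M] g that M by (simp add: even_powr mult.assoc)
  moreover have "complex_of_real (multi_deriv \<alpha> H x) =
        \<i> ^ M * complex_of_real (C_const p / C_const (p - real M)) *
        complex_of_real (\<integral>\<xi>. \<bar>x \<bullet> \<xi>\<bar> powr (p - real M) *
           (\<Prod>j\<in>UNIV. (\<xi> $ j) ^ \<alpha> j) * f \<xi> \<partial>spherical_lebesgue)" if "x \<noteq> 0" for x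
    unfolding const deriv[OF that]
    by (simp add: ridge_deriv_def ridge_integral_def even_powr mult.assoc)
  ultimately show ?thesis unfolding M_def by blast
qed

end
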